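(* Let $J$ be an arbitrary index set, let $(e_j)_{j\in J}$ be distinct transmission lines in $E$ and let $\tilde\tau_j\in(0,\bar\tau]$ for $j\in J$. For each $j\in J$ let $S^*_{\alpha,j}\in\mathcal{S}^*_\alpha(e_j,\tilde\tau_j)$ be a Correlation Index. Suppose $S^*\in2^S$ is a set of target substations such that $S^*_{\alpha,j}\subset S^*$ for all $j\in J$. Then the coordinated cyber-attack $S^*$ can increase the flow ($\tilde\tau_j$) on any line of $\{e_j\}_{j\in J}$, that is, $S^*\in\mathcal{S}_\alpha(e_j,\tilde\tau_j)$ for all $j\in J$.
   Context: Power grid: a finite graph $G=(V,E)$ with $n=|V|$ buses and $m=|E|$ transmission lines, and a finite set of substations $S=\{s_1,\dots,s_{n_s}\}$. Substation $s_k$ has a service area, a subgraph $G_{s_k}=(V_{s_k},E_{s_k})$ of $G$, with $\bigcup_k G_{s_k}=G$; service areas may overlap, but the overlaps contain no buses with generation. Given data: demand $P_d\in\mathbb{R}_{\ge0}^n$, generation limits $\bar P_g\in\mathbb{R}_{\ge0}^n$, line capacities $\bar P_f\in\mathbb{R}_{\ge0}^m$, a generator shift matrix $F\in\mathbb{R}^{m\times n}$ (with row $[F]_e$ for $e\in E$), cost data $c_2,c_1\in\mathbb{R}^n_{\ge0}$, $c_0\in\mathbb{R}$, $C_2=\mathrm{diag}(c_2)$, an attack bound $\bar a>0$, and $\bar\tau>0$. Security Constrained Economic Dispatch (SCED) under an attack signal $a\in\mathbb{R}^n$: minimize $\frac12P_g^\top C_2P_g+c_1^\top P_g+c_0$ over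 $P_g\in\mathbb{R}^n$ subject to $\mathbf 1^\top P_g=\mathbf 1^\top(P_d+a)$, $\mathbf 0\preceq P_g\preceq\bar P_g$ and $-\bar P_f\preceq F(P_g-P_d-a)\preceq\bar P_f$ (entrywise inequalities). The objective is assumed strictly convex in $P_g$. $P_g^*(a)$ denotes the optimal solution when the problem is feasible; the problem is assumed feasible for $a=0$. The flow on line $e$ before the attack is $P_{f,e}(0)=[F]_e(P_g^*(0)-P_d)$. A coordinated cyber-attack (CCA) is identified with the set $T\in2^S$ of its target substations. Put $\delta_{s_k}=1$ if $s_k\in T$ and $\delta_{s_k}=0$ otherwise. An attack signal $a\in\mathbb{R}^n$ is admissible for $T$ if $a_i\in\delta_{s_k}[-\bar a,\bar a]$ for all $s_k\in S$ and all $i\in V_{s_k}$. The CCA $T$ is effective for the attack goal $(e,\tilde\tau)$ (with $e\in E$, $\tilde\tau\in(0,\bar\tau]$), written $T\to(e,\tilde\tau)$, if there is an admissible $a$ for $T$ such that SCED under $a$ is feasible and $[F]_e(P_g^*(a)-P_d)\ge(1+\tilde\tau)P_{f,e}(0)$ if $P_{f,e}(0)\ge0$, respectively $[F]_e(P_g^*(a)-P_d)\le(1+\tilde\tau)P_{f,e}(0)$ if $P_{f,e}(0)<0$. The set of effective CCAs is $\mathcal{S}_\alpha(e,\tilde\tau)=\{T\in2^S: T\to(e,\tilde\tau)\}$. The security index $\kappa^*$ for $(e,\tilde\tau)$ is the least number of target substations of an effective CCA, $\kappa^*=\min\{|T|:T\in\mathcal{S}_\alpha(e,\tilde\tau)\}$.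 A Correlation Index (CI) for $(e,\tilde\tau)$ is an effective CCA with exactly $\kappa^*$ target substations; $\mathcal{S}^*_\alpha(e,\tilde\tau)\subseteq\mathcal{S}_\alpha(e,\tilde\tau)$ is the set of all CIs. Convention: $\subset$ denotes proper inclusion, $\subseteq$ inclusion. *)

theory Defs
  imports "HOL-Analysis.Analysis"
begin

definition strictly_convex_on :: "'a::real_vector set \<Rightarrow> ('a \<Rightarrow> real) \<Rightarrow> bool" where
  "strictly_convex_on S f \<longleftrightarrow> convex S \<and>
     (\<forall>x\<in>S. \<forall>y\<in>S. x \<noteq> y \<longrightarrow>
        (\<forall>u. 0 < u \<and> u < 1 \<longrightarrow>
          f ((1 - u) *\<^sub>R x + u *\<^sub>R y) < (1 - u) * f x + u * f y))"

definition diag :: "real ^ 'n \<Rightarrow> real ^ 'n ^ 'n" where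
  "diag c = (\<chi> i j. if i = j then c $ i else 0)"


text \<open>
  The finite index types \<open>'n\<close>, \<open>'m\<close>, \<open>'s\<close> are the sets of buses, transmission lines and
  substations. The graph is given by the two end buses of each line; parallel lines are allowed.
  The service area of substation \<open>s\<close> is the subgraph with buses \<open>area_buses s\<close> and
  lines \<open>area_lines s\<close>.
\<close>

record ('n, 'm, 's) power_grid_data =
  line_ends :: "'m::finite \<Rightarrow> 'n::finite set"
  area_buses :: "'s::finite \<Rightarrow> 'n set"
  area_lines :: "'s \<Rightarrow> 'm set"
  demand :: "real ^ 'n"
  gen_limit :: "real ^ 'n"
  line_cap :: "real ^ 'm"
  shift_matrix :: "real ^ 'n ^ 'm"
  cost2 :: "real ^ 'n"
  cost1 :: "real ^ 'n"
  cost0 :: real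
  attack_bound :: real
  goal_bound :: real


subsection \<open>Security constrained economic dispatch under an attack signal\<close>

definition sced_cost ::
    "('n::finite, 'm::finite, 's::finite) power_grid_data \<Rightarrow> real ^ 'n \<Rightarrow> real" where
  "sced_cost G Pg = 1 / 2 * (Pg \<bullet> (diag (cost2 G) *v Pg)) + cost1 G \<bullet> Pg + cost0 G"

text \<open>Here \<open>1\<close> is the all-ones vector, and \<open>\<le>\<close> on vectors is entrywise.\<close>

definition sced_feasible ::
    "('n::finite, 'm::finite, 's::finite) power_grid_data \<Rightarrow> real ^ 'n \<Rightarrow> (real ^ 'n) set" where
  "sced_feasible G a =
    {Pg. 1 \<bullet> Pg = 1 \<bullet> (demand G + a) \<and>
         0 \<le> Pg \<and> Pg \<le> gen_limit G \<and>
         - line_cap G \<le> shift_matrix G *v (Pg - demand G - a) \<and>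
         shift_matrix G *v (Pg - demand G - a) \<le> line_cap G}"

text \<open>Only meaningful if \<open>sced_feasible G a \<noteq> {}\<close>; the minimiser is then unique in a power grid
  (\<open>ex1_sced_opt\<close> below).\<close>

definition sced_opt ::
    "('n::finite, 'm::finite, 's::finite) power_grid_data \<Rightarrow> real ^ 'n \<Rightarrow> real ^ 'n" where
  "sced_opt G a = arg_min_on (sced_cost G) (sced_feasible G a)"

text \<open>The physical flow on a line: the attack changes the dispatch, but not the actual demand.\<close>

definition line_flow ::
    "('n::finite, 'm::finite, 's::finite) power_grid_data \<Rightarrow> 'm \<Rightarrow> real ^ 'n \<Rightarrow> real" where
  "line_flow G e a = row e (shift_matrix G) \<bullet> (sced_opt G a - demand G)"


subsection \<open>Power grids\<close>

text \<open>A bus with generation is a bus whose generation limit is positive.\<close>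

locale power_grid =
  fixes G :: "('n::finite, 'm::finite, 's::finite) power_grid_data"
  assumes line_ends: "card (line_ends G e) = 2"
    and area_subgraph: "e \<in> area_lines G s \<Longrightarrow> line_ends G e \<subseteq> area_buses G s"
    and area_buses_cover: "(\<Union>s. area_buses G s) = UNIV"
    and area_lines_cover: "(\<Union>s. area_lines G s) = UNIV"
    and overlap_no_generation:
      "s \<noteq> s' \<Longrightarrow> i \<in> area_buses G s \<inter> area_buses G s' \<Longrightarrow> gen_limit G $ i = 0"
    and demand_nonneg: "0 \<le> demand G"
    and gen_limit_nonneg: "0 \<le> gen_limit G"
    and line_cap_nonneg: "0 \<le> line_cap G"
    and cost2_nonneg: "0 \<le> cost2 G"
    and cost1_nonneg: "0 \<le> cost1 G"
    and attack_bound_pos: "0 < attack_bound G"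
    and goal_bound_pos: "0 < goal_bound G"
    and cost_strictly_convex: "strictly_convex_on UNIV (sced_cost G)"
    and feasible_0: "sced_feasible G 0 \<noteq> {}"
begin

lemma ex1_sced_opt:
  assumes "sced_feasible G a \<noteq> {}"
  shows "\<exists>!P. is_arg_min (sced_cost G) (\<lambda>P. P \<in> sced_feasible G a) P"
proof -
  let ?X = "sced_feasible G a" and ?f = "sced_cost G"
  let ?F = "shift_matrix G" and ?d = "shift_matrix G *v (demand G + a)"
  have "?F *v (Pg - demand G - a) = ?F *v Pg - ?d" for Pg
    by (simp add: matrix_vector_mult_diff_distrib matrix_vector_right_distrib)
  then have X: "?X = {Pg. 1 \<bullet> Pg = 1 \<bullet> (demand G + a)} \<inter> cbox 0 (gen_limit G) \<inter>
     ((*v) ?F -` cbox (?d - line_cap G) (?d + line_cap G))"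
    unfolding sced_feasible_def interval_cbox_cart[symmetric]
    by (auto simp: less_eq_vec_def algebra_simps)
  have lin: "linear ((*v) ?F)" by simp
  have "closed ((*v) ?F -` cbox (?d - line_cap G) (?d + line_cap G))"
    by (intro closed_vimage closed_cbox linear_continuous_on linear_linear[THEN iffD2] lin)
  then have compact: "compact ?X"
    unfolding X by (intro compact_Int_closed closed_Int_compact compact_cbox closed_hyperplane)
  have conv: "convex ?X"
    unfolding X by (intro convex_Int convex_hyperplane convex_box convex_linear_vimage lin)
  have "continuous_on ?X ?f"
    unfolding sced_cost_def
    by (intro continuous_intros linear_continuous_on linear_linear[THEN iffD2]) simp
  then obtain P where P: "P \<in> ?X" "\<And>Q. Q \<in> ?X \<Longrightarrow> ?f P \<le> ?f Q"
    using continuous_attains_inf[OF compact assms] by blast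
  have uniq: "Q = P" if "is_arg_min ?f (\<lambda>P. P \<in> ?X) Q" for Q
  proof (rule ccontr)
    assume ne: "Q \<noteq> P"
    let ?M = "(1 - 1/2) *\<^sub>R Q + (1/2) *\<^sub>R P"
    have Q: "Q \<in> ?X" "?f Q \<le> ?f P"
      using that P by (auto simp: is_arg_min_def not_less)
    have "\<forall>u. 0 < u \<and> u < 1 \<longrightarrow>
        ?f ((1 - u) *\<^sub>R Q + u *\<^sub>R P) < (1 - u) * ?f Q + u * ?f P"
      using cost_strictly_convex ne unfolding strictly_convex_on_def by simp
    from this[rule_format, of "1/2"]
    have "?f ?M < (1 - 1/2) * ?f Q + 1/2 * ?f P" by simp
    moreover have "?M \<in> ?X"
      by (rule convexD[OF conv Q(1) P(1)]) auto
    ultimately show False using P(2)[of ?M] Q by auto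
  qed
  show ?thesis
    using P uniq by (intro ex1I[of _ P]) (auto simp: is_arg_min_def not_less)
qed

end


subsection \<open>Coordinated cyber-attacks\<close>

definition admissible ::
    "('n::finite, 'm::finite, 's::finite) power_grid_data \<Rightarrow> 's set \<Rightarrow> real ^ 'n \<Rightarrow> bool" where
  "admissible G T a \<longleftrightarrow>
     (\<forall>s. \<forall>i\<in>area_buses G s.
        a $ i \<in> (\<lambda>x. indicator T s * x) ` {- attack_bound G..attack_bound G})"

definition effective ::
    "('n::finite, 'm::finite, 's::finite) power_grid_data \<Rightarrow> 's set \<Rightarrow> 'm \<Rightarrow> real \<Rightarrow> bool" where
  "effective G T e \<tau> \<longleftrightarrow>
     (\<exists>a. admissible G T a \<and> sced_feasible G a \<noteq> {} \<and>
        (if line_flow G e 0 \<ge> 0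
         then line_flow G e a \<ge> (1 + \<tau>) * line_flow G e 0
         else line_flow G e a \<le> (1 + \<tau>) * line_flow G e 0))"

definition effective_attacks ::
    "('n::finite, 'm::finite, 's::finite) power_grid_data \<Rightarrow> 'm \<Rightarrow> real \<Rightarrow> 's set set" where
  "effective_attacks G e \<tau> = {T. effective G T e \<tau>}"

text \<open>Only meaningful if \<open>effective_attacks G e \<tau> \<noteq> {}\<close>.\<close>

definition security_index ::
    "('n::finite, 'm::finite, 's::finite) power_grid_data \<Rightarrow> 'm \<Rightarrow> real \<Rightarrow> nat" where
  "security_index G e \<tau> = Min (card ` effective_attacks G e \<tau>)"

definition correlation_indices ::
    "('n::finite, 'm::finite, 's::finite) power_grid_data \<Rightarrow> 'm \<Rightarrow> real \<Rightarrow> 's set set" where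
  "correlation_indices G e \<tau> =
     {T \<in> effective_attacks G e \<tau>. card T = security_index G e \<tau>}"

end

theory Submission
  imports Defs
begin

text \<open>
  The zero signal is allowed at every substation, so enlarging the set of target substations only
  enlarges the set of admissible attack signals; the dispatch and the flow depend on the signal alone.
\<close>

lemma admissible_mono:
  assumes "0 \<le> attack_bound G" and "T \<subseteq> T'" and adm: "admissible G T a"
  shows "admissible G T' a"
  unfolding admissible_def
proof (intro allI ballI)
  fix s i
  assume i: "i \<in> area_buses G s"
  then have range: "a $ i \<in> (\<lambda>x. indicator T s * x) ` {- attack_bound G..attack_bound G}"
    using adm by (simp add: admissible_def)
  show "a $ i \<in> (\<lambda>x. indicator T' s * x) ` {- attack_bound G..attack_bound G}"
  \<comment> \<open>If \<open>s\<close> lies in \<open>T\<close>, it also lies in \<open>T'\<close>,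
    so both indicators are 1 and the two ranges coincide.\<close>
  proof (cases "s \<in> T")
    case True
    with range \<open>T \<subseteq> T'\<close> show ?thesis by (auto simp: subset_iff)
  next
    case False
    with range have "a $ i = 0" by auto
    \<comment> \<open>The witness 0 gives the product 0 whether or not \<open>s\<close> lies in
      \<open>T'\<close>; it lies in the attack interval because the bound is nonnegative.\<close>
    with assms(1) show ?thesis by (auto intro!: image_eqI[where x = 0])
  qed
qed

text \<open>The signal that makes \<open>T\<close> effective serves for \<open>T'\<close> as well:
  in \<open>effective\<close>, the target set enters only through admissibility.\<close>

lemma effective_attacks_mono:
  assumes "0 \<le> attack_bound G" and "T \<subseteq> T'" and "T \<in> effective_attacks G e \<tau>"
  shows "T' \<in> effective_attacks G e \<tau>"
  using assms admissible_mono[OF assms(1,2)]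
  unfolding effective_attacks_def effective_def by blast

theorem theorem1:
  fixes G :: "('n::finite, 'm::finite, 's::finite) power_grid_data"
    and J :: "'j set"
    and e :: "'j \<Rightarrow> 'm"
    and \<tau> :: "'j \<Rightarrow> real"
    and CI :: "'j \<Rightarrow> 's set"
    and S_star :: "'s set"
  assumes "power_grid G"
    and "inj_on e J"
    and "\<And>j. j \<in> J \<Longrightarrow> \<tau> j \<in> {0<..goal_bound G}"
    and "\<And>j. j \<in> J \<Longrightarrow> CI j \<in> correlation_indices G (e j) (\<tau> j)"
    and "\<And>j. j \<in> J \<Longrightarrow> CI j \<subset> S_star"
  shows "\<forall>j\<in>J. S_star \<in> effective_attacks G (e j) (\<tau> j)"
proof
  fix j
  assume j: "j \<in> J"
  \<comment> \<open>Each \<open>j\<close> is handled separately, by passing from \<open>CI j\<close>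
    up to \<open>S_star\<close>; this bound puts the zero signal in the attack interval.\<close>
  have "0 \<le> attack_bound G"
    using power_grid.attack_bound_pos[OF assms(1)] by simp
  moreover have "CI j \<subseteq> S_star"
    using assms(5)[OF j] by blast
  moreover have "CI j \<in> effective_attacks G (e j) (\<tau> j)"
    using assms(4)[OF j] by (simp add: correlation_indices_def)
  ultimately show "S_star \<in> effective_attacks G (e j) (\<tau> j)"
    by (rule effective_attacks_mono)
qed

end
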